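(* Let $n\geq 2$ and $j\geq 3$ be integers. Then \[ m_j(K_3,K_{1,n})=\Big\lfloor \frac{n-1}{\lceil \frac{j}{2}\rceil-1}\Big\rfloor+1 . \]
   Context: All graphs are simple; $K_3$ is the triangle and $K_{1,n}$ is the star with $n+1$ vertices ($n$ leaves). For integers $j\geq 2$ and $t\geq 1$, $K_{j\times t}$ denotes the complete multipartite graph with $j$ parts, each of size $t$. For graphs $H$ and $G$, the size multipartite Ramsey number $m_j(H,G)$ is the smallest natural number $t$ such that every coloring of the edges of $K_{j\times t}$ with two colors red and blue contains a red copy of $H$ or a blue copy of $G$ as a subgraph. *)

theory Defs
  imports Complex_Main
begin

type_synonym 'v graph = "'v set \<times> 'v set set"

abbreviation verts :: "'v graph \<Rightarrow> 'v set" where "verts G \<equiv> fst G"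
abbreviation edges :: "'v graph \<Rightarrow> 'v set set" where "edges G \<equiv> snd G"

definition simple_graph :: "'v graph \<Rightarrow> bool" where
  "simple_graph G \<longleftrightarrow> (\<forall>e\<in>edges G. e \<subseteq> verts G \<and> card e = 2)"

text \<open>A copy is a not necessarily induced subgraph isomorphic to \<open>H\<close>.\<close>

definition contains_copy :: "'v graph \<Rightarrow> 'w graph \<Rightarrow> bool" where
  "contains_copy H G \<longleftrightarrow>
     (\<exists>f. inj_on f (verts H) \<and> f ` verts H \<subseteq> verts G \<and> (\<forall>e\<in>edges H. f ` e \<in> edges G))"

definition complete_graph :: "nat \<Rightarrow> nat graph" where
  "complete_graph n = ({..<n}, {{u, v} | u v. u < n \<and> v < n \<and> u \<noteq> v})"

text \<open>The centre of the star is \<open>0\<close>, its leaves are \<open>1, \<dots>, n\<close>.\<close>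

definition star :: "nat \<Rightarrow> nat graph" where
  "star n = ({0..n}, {{0, i} | i. i \<in> {1..n}})"

text \<open>The vertex \<open>(i, k)\<close> is the \<open>k\<close>-th vertex of the \<open>i\<close>-th part.\<close>

definition complete_multipartite :: "nat \<Rightarrow> nat \<Rightarrow> (nat \<times> nat) graph" where
  "complete_multipartite j t =
     ({..<j} \<times> {..<t},
      {{u, v} | u v. u \<in> {..<j} \<times> {..<t} \<and> v \<in> {..<j} \<times> {..<t} \<and> fst u \<noteq> fst v})"

datatype colour = Red | Blue

text \<open>Colourings are total functions on sets of vertices; only their values on edges matter.\<close>

definition colour_class :: "'v graph \<Rightarrow> ('v set \<Rightarrow> colour) \<Rightarrow> colour \<Rightarrow> 'v graph" where
  "colour_class G c x = (verts G, {e \<in> edges G. c e = x})"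

definition ramsey_arrows :: "'u graph \<Rightarrow> 'v graph \<Rightarrow> 'w graph \<Rightarrow> bool" where
  "ramsey_arrows F H G \<longleftrightarrow>
     (\<forall>c. contains_copy H (colour_class F c Red) \<or> contains_copy G (colour_class F c Blue))"

text \<open>The value is unspecified if no suitable \<open>t\<close> exists.\<close>

definition multipartite_ramsey :: "nat \<Rightarrow> 'v graph \<Rightarrow> 'w graph \<Rightarrow> nat" where
  "multipartite_ramsey j H G = (LEAST t. t \<ge> 1 \<and> ramsey_arrows (complete_multipartite j t) H G)"

lemma simple_graph_complete_graph: "simple_graph (complete_graph n)"
  by (auto simp: simple_graph_def complete_graph_def)

lemma simple_graph_star: "simple_graph (star n)"
  by (auto simp: simple_graph_def star_def)

lemma simple_graph_complete_multipartite: "simple_graph (complete_multipartite j t)"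
  by (fastforce simp: simple_graph_def complete_multipartite_def card_2_iff)

lemma simple_graph_colour_class: "simple_graph G \<Longrightarrow> simple_graph (colour_class G c x)"
  by (auto simp: simple_graph_def colour_class_def)

end

theory Submission
  imports Defs
begin

text \<open>
  Put \<open>k = \<lceil>j/2\<rceil> - 1\<close>. If \<open>k t < n\<close>, colour an edge red iff its parts have indices of different
  parity: red is bipartite and every blue degree is at most \<open>k t\<close>. If \<open>k t \<ge> n\<close> and no vertex has
  blue degree \<open>n\<close>, then all red degrees exceed \<open>(j - 1 - k) t\<close>, and a red triangle is forced:
  for even \<open>j\<close> because two adjacent vertices have a common neighbour; for \<open>j = 3\<close> by Graver's
  argument, looking at a vertex with the most neighbours in a single part; for odd \<open>j \<ge> 5\<close> because a
  triangle-free red graph would have no 5-cycle, hence would be bipartite (as in the theorem of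
  Andrasfai), and the degree condition makes the two sides unions of parts, one side containing at
  least \<open>k + 1\<close> of the parts.
\<close>

section \<open>Triangle-free graphs: degree sums and bipartiteness\<close>

locale triangle_free =
  fixes V :: "'a set" and R :: "'a \<Rightarrow> 'a \<Rightarrow> bool"
  assumes finite_V: "finite V"
    and adj_in_V: "R u v \<Longrightarrow> u \<in> V"
    and sym: "R u v \<Longrightarrow> R v u"
    and no_triangle: "R u v \<Longrightarrow> R v w \<Longrightarrow> R u w \<Longrightarrow> False"
begin

definition nbrs :: "'a \<Rightarrow> 'a set" where
  "nbrs v = {u. R v u}"

lemma nbrs_subset: "nbrs v \<subseteq> V"
  using adj_in_V sym by (auto simp: nbrs_def)

lemma finite_nbrs: "finite (nbrs v)"
  using nbrs_subset finite_V by (rule finite_subset)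

lemma nbrs_disjoint: "R u v \<Longrightarrow> nbrs u \<inter> nbrs v = {}"
  using no_triangle sym by (auto simp: nbrs_def)

lemma card_nbrs_adjacent:
  assumes "R u v" "nbrs u \<union> nbrs v \<subseteq> S" "finite S"
  shows "card (nbrs u) + card (nbrs v) \<le> card S"
proof -
  have "card (nbrs u) + card (nbrs v) = card (nbrs u \<union> nbrs v)"
    using nbrs_disjoint[OF assms(1)] by (simp add: card_Un_disjoint finite_nbrs)
  also have "\<dots> \<le> card S"
    using assms by (intro card_mono) auto
  finally show ?thesis .
qed

text \<open>Double counting: among any three of the five vertices two are consecutive, so a vertex
  adjacent to three of them would close a triangle. Hence each vertex of \<open>V\<close> is counted
  at most twice.\<close>

lemma five_cycle_degree_sum:
  assumes "R a b" "R b c" "R c d" "R d e" "R e a"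
  shows "card (nbrs a) + card (nbrs b) + card (nbrs c) + card (nbrs d) + card (nbrs e) \<le> 2 * card V"
proof -
  have deg: "card (nbrs v) = (\<Sum>u\<in>V. if R v u then 1 else 0)" for v
  proof -
    have "nbrs v = {u \<in> V. R v u}"
      using nbrs_subset by (auto simp: nbrs_def)
    then show ?thesis
      using finite_V by (simp add: sum.If_cases Int_def)
  qed
  let ?i = "\<lambda>v u. if R v u then 1 else (0::nat)"
  have "card (nbrs a) + card (nbrs b) + card (nbrs c) + card (nbrs d) + card (nbrs e)
      = (\<Sum>u\<in>V. ?i a u + ?i b u + ?i c u + ?i d u + ?i e u)"
    by (simp only: deg sum.distrib)
  also have "\<dots> \<le> (\<Sum>u\<in>V. 2)"
  proof (rule sum_mono)
    fix u
    show "?i a u + ?i b u + ?i c u + ?i d u + ?i e u \<le> 2"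
      using no_triangle[of a b u] no_triangle[of b c u] no_triangle[of c d u]
        no_triangle[of d e u] no_triangle[of e a u] assms
      by auto
  qed
  finally show ?thesis by simp
qed

text \<open>Fix an edge from \<open>x\<close> to \<open>y\<close>. A vertex with neighbours in both
  \<open>nbrs x\<close> and \<open>nbrs y\<close> would close a 5-cycle whose degree sum exceeds
  \<open>2 * card V\<close>. So the vertices split into those without a neighbour in
  \<open>nbrs y\<close> and the rest, which have none in \<open>nbrs x\<close>.\<close>

lemma bipartite_of_large_degree:
  assumes deg: "\<And>v. v \<in> V \<Longrightarrow> 2 * card V < 5 * card (nbrs v)"
    and "V \<noteq> {}"
  obtains X Y where "X \<union> Y = V" "X \<inter> Y = {}"
    "\<And>u v. u \<in> X \<Longrightarrow> v \<in> X \<Longrightarrow> \<not> R u v" "\<And>u v. u \<in> Y \<Longrightarrow> v \<in> Y \<Longrightarrow> \<not> R u v"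
proof -
  obtain x where x: "x \<in> V" using \<open>V \<noteq> {}\<close> by auto
  have "nbrs x \<noteq> {}" using deg[OF x] by auto
  then obtain y where xy: "R x y" by (auto simp: nbrs_def)
  have y: "y \<in> V" using xy adj_in_V sym by blast
  define A where "A = nbrs y"
  define B where "B = nbrs x"
  define X where "X = {w \<in> V. \<forall>a\<in>A. \<not> R w a}"
  have one_side: "\<not> (R w a \<and> R w b)" if "w \<in> V" "a \<in> A" "b \<in> B" for w a b
  proof
    assume w: "R w a \<and> R w b"
    have c: "R w a" "R a y" "R y x" "R x b" "R b w"
      using w that xy sym by (auto simp: A_def B_def nbrs_def)
    have "a \<in> V" "b \<in> V" using c adj_in_V by blast+
    then show False
      using five_cycle_degree_sum[OF c] deg[of w] deg[of a] deg[of y] deg[of x] deg[of b] x y that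
      by linarith
  qed
  \<comment> \<open>The neighbourhoods of \<open>u\<close> and \<open>v\<close> are disjoint and
    avoid that of \<open>z\<close>, so three degrees sum to at most \<open>card V\<close>, whereas
    each exceeds two fifths of it. Taking \<open>z = y\<close> excludes edges inside
    \<open>X\<close>, and \<open>z = x\<close> excludes edges inside \<open>V - X\<close>.\<close>
  have indep: False
    if uv: "R u v" and S: "\<And>s. s \<in> S \<Longrightarrow> \<not> R u s \<and> \<not> R v s"
      and S': "S = nbrs z" and z: "z \<in> V" for u v S z
  proof -
    have "nbrs u \<union> nbrs v \<subseteq> V - S"
      using nbrs_subset S by (auto simp: nbrs_def)
    then have "card (nbrs u) + card (nbrs v) \<le> card (V - S)"
      using card_nbrs_adjacent[OF uv] finite_V by blast
    also have "card (V - S) = card V - card (nbrs z)"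
      using nbrs_subset[of z] by (simp add: S' card_Diff_subset finite_nbrs)
    finally show False
      using deg[of u] deg[of v] deg[OF z] uv adj_in_V sym by fastforce
  qed
  have indepX: "\<not> R u v" if "u \<in> X" "v \<in> X" for u v
    using indep[of u v A y] that y by (auto simp: X_def A_def)
  have indepY: "\<not> R u v" if "u \<in> V - X" "v \<in> V - X" for u v
    using indep[of u v B x] that x one_side by (fastforce simp: X_def B_def)
  have "X \<union> (V - X) = V" "X \<inter> (V - X) = {}" by (auto simp: X_def)
  then show ?thesis using indepX indepY by (rule that)
qed

end

section \<open>Minimum degree of triangle-free subgraphs of the complete multipartite graph\<close>

locale triangle_free_multipartite = triangle_free "{..<j} \<times> {..<t}" R
  for j t :: nat and R :: "nat \<times> nat \<Rightarrow> nat \<times> nat \<Rightarrow> bool" +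
  assumes adj_parts: "R u v \<Longrightarrow> fst u \<noteq> fst v"
begin

abbreviation part :: "nat \<Rightarrow> (nat \<times> nat) set" where
  "part i \<equiv> {i} \<times> {..<t}"

text \<open>The neighbours of \<open>x\<close> lie outside its own part and outside
  \<open>X\<close>. Since there are more than \<open>(j - 1 - k) * t\<close> of them, fewer than
  \<open>k * t\<close> vertices of \<open>X\<close> can lie in the other parts.\<close>

lemma independent_card_less:
  assumes indep: "\<And>u v. u \<in> X \<Longrightarrow> v \<in> X \<Longrightarrow> \<not> R u v"
    and X: "X \<subseteq> {..<j} \<times> {..<t}" "x \<in> X"
    and deg: "(j - 1 - k) * t < card (nbrs x)" and "k < j"
  shows "card X < k * t + card (X \<inter> part (fst x))"
proof -
  have fin: "finite X" using X finite_V finite_subset by blast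
  have x: "fst x < j" using X by auto
  have "nbrs x \<subseteq> ({..<j} - {fst x}) \<times> {..<t} - (X - part (fst x))"
    using nbrs_subset[of x] adj_parts[of x] indep[of x] X by (force simp: nbrs_def)
  then have "card (nbrs x) \<le> card (({..<j} - {fst x}) \<times> {..<t} - (X - part (fst x)))"
    by (intro card_mono) auto
  also have "\<dots> = card (({..<j} - {fst x}) \<times> {..<t}) - card (X - part (fst x))"
    using X fin by (intro card_Diff_subset) auto
  also have "card (({..<j} - {fst x}) \<times> {..<t}) = (j - 1) * t"
    using x by (simp add: card_cartesian_product)
  finally have "card (nbrs x) \<le> (j - 1) * t - card (X - part (fst x))" .
  moreover have "(j - 1) * t = (j - 1 - k) * t + k * t"
    using \<open>k < j\<close> by (simp flip: add_mult_distrib)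
  moreover have "card X = card (X - part (fst x)) + card (X \<inter> part (fst x))"
    using fin card_Int_Diff[of X "part (fst x)"] by simp
  ultimately show ?thesis
    using deg by linarith
qed

text \<open>Here \<open>(k + 1) * t\<close> is half the number of vertices, so the ends of an edge
  cannot both have larger degree and still have disjoint neighbourhoods.\<close>

lemma min_degree_bound_even:
  assumes "j = 2 * k + 2" "t > 0"
  shows "\<exists>v \<in> {..<j} \<times> {..<t}. card (nbrs v) \<le> (k + 1) * t"
proof (rule ccontr)
  assume "\<not> ?thesis"
  then have deg: "(k + 1) * t < card (nbrs v)" if "v \<in> {..<j} \<times> {..<t}" for v
    using that by force
  have x: "(0, 0) \<in> {..<j} \<times> {..<t}" using assms by auto
  have "nbrs (0, 0) \<noteq> {}" using deg[OF x] by auto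
  then obtain y where y: "R (0, 0) y" by (auto simp: nbrs_def)
  have "card (nbrs (0, 0)) + card (nbrs y) \<le> j * t"
    using card_nbrs_adjacent[OF y, of "{..<j} \<times> {..<t}"] nbrs_subset by simp
  then show False
    using deg[OF x] deg[of y] y sym adj_in_V assms by (fastforce simp: algebra_simps)
qed

text \<open>Let \<open>x\<close> have the most neighbours in a single part \<open>b\<close>, and let
  \<open>z\<close> be a neighbour of \<open>x\<close> in the third part. Inside part
  \<open>b\<close> the neighbourhoods of \<open>x\<close> and \<open>z\<close> are disjoint, so what
  \<open>x\<close> takes there is lost to \<open>z\<close>. If \<open>z\<close> has degree above
  \<open>t\<close>, it has more neighbours in the part of \<open>x\<close> than \<open>x\<close> has
  in part \<open>b\<close>, against maximality.\<close>

lemma min_degree_bound_three: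
  assumes "j = 3" "t > 0"
  shows "\<exists>v \<in> {..<j} \<times> {..<t}. card (nbrs v) \<le> t"
proof (rule ccontr)
  assume "\<not> ?thesis"
  then have deg: "t < card (nbrs v)" if "v \<in> {..<j} \<times> {..<t}" for v
    using that by force
  define d where "d = (\<lambda>(v, i). card (nbrs v \<inter> part i))"
  let ?D = "({..<j} \<times> {..<t}) \<times> {..<j}"
  have fin: "finite (d ` ?D)" by simp
  have "((0, 0), 0) \<in> ?D" using assms by auto
  then have "Max (d ` ?D) \<in> d ` ?D" by (intro Max_in fin) blast
  then obtain p where p_Max: "Max (d ` ?D) = d p" and p_in: "p \<in> ?D" by (rule imageE)
  have p_max: "d q \<le> d p" if "q \<in> ?D" for q
    using Max_ge[OF fin imageI[OF that]] by (simp only: p_Max)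
  obtain x b0 where x: "x \<in> {..<j} \<times> {..<t}" and "b0 < j" and p_eq: "p = (x, b0)"
    using p_in by auto
  have own: "nbrs v \<inter> part (fst v) = {}" for v
    using adj_parts[of v] by (force simp: nbrs_def)
  have split: "card (nbrs v) = d (v, fst v) + d (v, b) + d (v, c)"
    if "{fst v, b, c} = {0, 1, 2}" for v b c
  proof -
    have "{..<j} = {0, 1, 2}" using \<open>j = 3\<close> by auto
    then have "nbrs v \<subseteq> {fst v, b, c} \<times> {..<t}"
      using nbrs_subset[of v] that by simp
    then have "nbrs v = (nbrs v \<inter> part b) \<union> (nbrs v \<inter> part c)"
      using own[of v] by auto
    moreover have "b \<noteq> c" 
    proof
      assume "b = c"
      then have "card {fst v, b, c} \<le> 2" by (simp add: card_insert_if)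
      then show False unfolding that by simp
    qed
    then have "(nbrs v \<inter> part b) \<inter> (nbrs v \<inter> part c) = {}" by auto
    ultimately have "card (nbrs v) = card (nbrs v \<inter> part b) + card (nbrs v \<inter> part c)"
      by (metis card_Un_disjoint finite_Int finite_nbrs)
    then show ?thesis using own[of v] by (simp add: d_def)
  qed
  have d_le: "d (v, i) \<le> t" for v i
    using card_mono[of "part i" "nbrs v \<inter> part i"] by (simp add: d_def)
  have own_d: "d (v, fst v) = 0" for v using own by (simp add: d_def)
  have fstx: "fst x < 3" using x \<open>j = 3\<close> by auto
  \<comment> \<open>The maximum ranges over all pairs, including a vertex with its own part. It can
    be attained there only if it is 0, and then any other part serves as well.\<close>
  have "\<exists>b. b < 3 \<and> b \<noteq> fst x \<and> d p \<le> d (x, b)"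
  proof (cases "b0 = fst x")
    case True
    then have "d p = 0" using own_d p_eq by simp
    then show ?thesis by (intro exI[of _ "if fst x = 0 then 1 else 0"]) auto
  qed (use p_eq \<open>b0 < j\<close> \<open>j = 3\<close> in auto)
  then obtain b where b: "b < 3" "b \<noteq> fst x" "d p \<le> d (x, b)" by blast
  \<comment> \<open>The three indices add up to 3, so this is the remaining one.\<close>
  define c where "c = 3 - fst x - b"
  have abc: "{fst x, b, c} = {0, 1, 2}"
  proof -
    have "fst x \<in> {0, 1, 2}" "b \<in> {0, 1, 2}" using b fstx by auto
    then show ?thesis
      using b(2) by (auto simp: c_def)
  qed
  \<comment> \<open>Part \<open>b\<close> holds at most \<open>t\<close> of the more than
    \<open>t\<close> neighbours of \<open>x\<close>.\<close>
  have "0 < d (x, c)"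
    using deg[OF x] split[OF abc] d_le[of x b] own_d[of x] by linarith
  then obtain z where z: "R x z" "fst z = c"
    by (force simp: d_def nbrs_def card_gt_0_iff)
  have zV: "z \<in> {..<j} \<times> {..<t}" using z sym adj_in_V by blast
  have "d (x, b) + d (z, b) = card ((nbrs x \<inter> part b) \<union> (nbrs z \<inter> part b))"
    using nbrs_disjoint[OF z(1)] unfolding d_def
    by (subst card_Un_disjoint) (auto simp: finite_nbrs)
  also have "\<dots> \<le> card (part b)" by (intro card_mono) auto
  finally have "d (x, b) + d (z, b) \<le> t" by simp
  moreover have "{fst z, fst x, b} = {0, 1, 2}"
    unfolding abc[symmetric] z(2) by (simp only: insert_commute)
  then have "t < d (z, fst x) + d (z, b)"
    using deg[OF zV] split[of z "fst x" b] own_d[of z] by simp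
  moreover have "d (z, fst x) \<le> d p"
    using p_max[of "(z, fst x)"] zV x by auto
  ultimately show False using b by linarith
qed

text \<open>With all degrees above \<open>k * t\<close> the graph would be bipartite with both sides
  unions of parts. Each side could hold at most \<open>k\<close> parts, too few to make up
  \<open>2 * k + 1\<close>.\<close>

lemma min_degree_bound_odd:
  assumes "j = 2 * k + 1" "k \<ge> 2" "t > 0"
  shows "\<exists>v \<in> {..<j} \<times> {..<t}. card (nbrs v) \<le> k * t"
proof (rule ccontr)
  let ?V = "{..<j} \<times> {..<t}"
  assume "\<not> ?thesis"
  then have deg: "k * t < card (nbrs v)" if "v \<in> ?V" for v
    using that by force
  \<comment> \<open>This is where \<open>k \<ge> 2\<close> enters:
    \<open>2 * (2 * k + 1) \<le> 5 * k\<close> fails for \<open>k = 1\<close>, which is why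
    \<open>j = 3\<close> is treated separately.\<close>
  have "2 * card ?V < 5 * card (nbrs v)" if "v \<in> ?V" for v
  proof -
    have "2 * t \<le> k * t" using \<open>k \<ge> 2\<close> by simp
    moreover have "card ?V = 2 * (k * t) + t" using assms by (simp add: algebra_simps)
    ultimately show ?thesis using deg[OF that] by linarith
  qed
  moreover have "?V \<noteq> {}" using assms by auto
  ultimately obtain X Y where XY: "X \<union> Y = ?V" "X \<inter> Y = {}"
    and indX: "\<And>u v. u \<in> X \<Longrightarrow> v \<in> X \<Longrightarrow> \<not> R u v"
    and indY: "\<And>u v. u \<in> Y \<Longrightarrow> v \<in> Y \<Longrightarrow> \<not> R u v"
    using bipartite_of_large_degree by metis
  have fin: "finite X" "finite Y" using XY finite_V by (metis finite_Un)+
  have jk: "j - 1 - k = k" "k < j" using assms by auto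
  have cardX: "card X < k * t + card (X \<inter> part (fst x))" if "x \<in> X" for x
    using independent_card_less[OF indX _ that, of k] XY deg[of x] that jk by auto
  have cardY: "card Y < k * t + card (Y \<inter> part (fst y))" if "y \<in> Y" for y
    using independent_card_less[OF indY _ that, of k] XY deg[of y] that jk by auto
  have cardV: "card X + card Y = 2 * (k * t) + t"
    using card_Un_disjoint[OF fin XY(2)] XY(1) assms by (simp add: algebra_simps)
  \<comment> \<open>If one part met both sides, adding the bounds \<open>cardX\<close> and
    \<open>cardY\<close> for it would give fewer than \<open>2 * (k * t) + t\<close> vertices in
    total.\<close>
  have parts_disjoint: "fst x \<noteq> fst y" if "x \<in> X" "y \<in> Y" for x y
  proof
    assume eq: "fst x = fst y"
    have "card (X \<inter> part (fst x)) + card (Y \<inter> part (fst x))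
        = card ((X \<inter> part (fst x)) \<union> (Y \<inter> part (fst x)))"
      using XY(2) by (subst card_Un_disjoint) (auto simp: fin)
    also have "\<dots> \<le> card (part (fst x))" by (intro card_mono) auto
    finally show False
      using cardX[OF that(1)] cardY[OF that(2)] eq cardV by simp
  qed
  have union_of_parts: "S = fst ` S \<times> {..<t}"
    if "S \<union> T = ?V" "\<And>x y. x \<in> S \<Longrightarrow> y \<in> T \<Longrightarrow> fst x \<noteq> fst y" for S T
  proof
    show "S \<subseteq> fst ` S \<times> {..<t}" using that(1) by force
    show "fst ` S \<times> {..<t} \<subseteq> S"
    proof
      fix w assume "w \<in> fst ` S \<times> {..<t}"
      then obtain s where s: "s \<in> S" "fst w = fst s" "snd w < t" by auto
      have "s \<in> ?V" using s that(1) by blast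
      then have "w \<in> ?V" using s by (auto simp: mem_Times_iff)
      then show "w \<in> S" using that s by fastforce
    qed
  qed
  have few_parts: "card (fst ` S) \<le> k"
    if S: "S = fst ` S \<times> {..<t}"
      and less: "\<And>x. x \<in> S \<Longrightarrow> card S < k * t + card (S \<inter> part (fst x))" for S
  proof (cases "S = {}")
    case False
    then obtain x where "x \<in> S" by auto
    have "card (S \<inter> part (fst x)) \<le> card (part (fst x))" by (intro card_mono) auto
    then have "card S < (k + 1) * t" using less[OF \<open>x \<in> S\<close>] by simp
    moreover have "card S = card (fst ` S) * t"
      by (subst S) (simp add: card_cartesian_product)
    ultimately have "card (fst ` S) * t < (k + 1) * t" by simp
    then have "card (fst ` S) < k + 1" by (rule mult_less_cancel2[THEN iffD1, THEN conjunct2])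
    then show ?thesis by simp
  qed simp
  have SX: "X = fst ` X \<times> {..<t}" using union_of_parts[OF XY(1) parts_disjoint] .
  have SY: "Y = fst ` Y \<times> {..<t}"
  proof (rule union_of_parts)
    show "Y \<union> X = ?V" using XY(1) by blast
    show "fst y \<noteq> fst x" if "y \<in> Y" "x \<in> X" for x y using parts_disjoint[OF that(2,1)] by simp
  qed
  have "card X \<le> k * t"
    by (subst SX) (use few_parts[OF SX cardX] in \<open>simp add: card_cartesian_product\<close>)
  moreover have "card Y \<le> k * t"
    by (subst SY) (use few_parts[OF SY cardY] in \<open>simp add: card_cartesian_product\<close>)
  ultimately show False using cardV \<open>t > 0\<close> by linarith
qed

text \<open>In the complete multipartite graph every degree is \<open>(j - 1) * t\<close>, so this
  bound leaves at least \<open>k * t\<close> edges outside \<open>R\<close> at \<open>v\<close>. The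
  factor \<open>j - 1 - k\<close> is \<open>k + 1\<close> for even \<open>j\<close> and
  \<open>k\<close> for odd \<open>j\<close>.\<close>

lemma min_degree_bound:
  assumes "j \<ge> 3" "t > 0" "k = (j - 1) div 2"
  shows "\<exists>v \<in> {..<j} \<times> {..<t}. card (nbrs v) \<le> (j - 1 - k) * t"
proof -
  consider "j = 2 * k + 2" | "j = 3" | "j = 2 * k + 1" "k \<ge> 2"
    using assms by linarith
  then show ?thesis
  proof cases
    case 1
    then show ?thesis using min_degree_bound_even[of k] \<open>t > 0\<close> by simp
  next
    case 2
    then show ?thesis using min_degree_bound_three assms by simp
  next
    case 3
    then show ?thesis using min_degree_bound_odd[of k] \<open>t > 0\<close> by simp
  qed
qed

end

section \<open>Arrowing in terms of red triangles and blue degrees\<close>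

lemma contains_triangle_iff:
  assumes "simple_graph G"
  shows "contains_copy (complete_graph 3) G \<longleftrightarrow>
    (\<exists>a b c. {a, b} \<in> edges G \<and> {b, c} \<in> edges G \<and> {a, c} \<in> edges G)"
proof
  assume "contains_copy (complete_graph 3) G"
  then obtain f where f: "\<forall>e\<in>edges (complete_graph 3). f ` e \<in> edges G"
    by (auto simp: contains_copy_def)
  have e: "{f u, f v} \<in> edges G" if "u < 3" "v < 3" "u \<noteq> v" for u v
    using bspec[OF f, of "{u, v}"] that by (auto simp: complete_graph_def)
  show "\<exists>a b c. {a, b} \<in> edges G \<and> {b, c} \<in> edges G \<and> {a, c} \<in> edges G"
    using e[of 0 1] e[of 1 2] e[of 0 2] by auto
next
  assume "\<exists>a b c. {a, b} \<in> edges G \<and> {b, c} \<in> edges G \<and> {a, c} \<in> edges G"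
  then obtain a b c where abc: "{a, b} \<in> edges G" "{b, c} \<in> edges G" "{a, c} \<in> edges G" by blast
  \<comment> \<open>Distinctness comes from edges having exactly two elements.\<close>
  have neq: "a \<noteq> b" "b \<noteq> c" "a \<noteq> c" and V: "{a, b, c} \<subseteq> verts G"
  proof -
    have "u \<noteq> v \<and> u \<in> verts G \<and> v \<in> verts G" if "{u, v} \<in> edges G" for u v
      using bspec[OF assms[unfolded simple_graph_def] that]
      by (auto simp: card_insert_if split: if_splits)
    then show "a \<noteq> b" "b \<noteq> c" "a \<noteq> c" "{a, b, c} \<subseteq> verts G" using abc by blast+
  qed
  define f where "f = (\<lambda>i::nat. if i = 0 then a else if i = 1 then b else c)"
  have three: "{..<3::nat} = {0, 1, 2}" by auto
  have "f ` e \<in> edges G" if e: "e \<in> edges (complete_graph 3)" for e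
  proof -
    obtain u v where uv: "e = {u, v}" "u \<in> {..<3}" "v \<in> {..<3}" "u \<noteq> v"
      using e unfolding complete_graph_def snd_conv mem_Collect_eq lessThan_iff by blast
    show ?thesis
      using uv abc unfolding three by (auto simp: f_def insert_commute)
  qed
  moreover have "inj_on f {..<3}" "f ` {..<3} \<subseteq> verts G"
    using neq V unfolding three by (auto simp: f_def inj_on_def)
  ultimately show "contains_copy (complete_graph 3) G"
    by (auto simp: contains_copy_def complete_graph_def)
qed

text \<open>Copies need not be induced, so any \<open>n\<close> neighbours of a vertex can serve as
  leaves.\<close>

lemma contains_star_iff:
  assumes "simple_graph G" "finite (verts G)"
  shows "contains_copy (star n) G \<longleftrightarrow> (\<exists>v \<in> verts G. n \<le> card {u. {v, u} \<in> edges G})"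
proof
  assume "contains_copy (star n) G"
  then obtain f where f: "inj_on f {0..n}" "f ` {0..n} \<subseteq> verts G"
    "\<forall>e\<in>edges (star n). f ` e \<in> edges G"
    by (auto simp: contains_copy_def star_def)
  have e: "{f 0, f i} \<in> edges G" if "i \<in> {1..n}" for i
    using bspec[OF f(3), of "{0, i}"] that by (auto simp: star_def)
  have "{u. {f 0, u} \<in> edges G} \<subseteq> verts G"
    using assms(1) by (auto simp: simple_graph_def)
  then have "finite {u. {f 0, u} \<in> edges G}"
    using assms(2) finite_subset by blast
  then have "card (f ` {1..n}) \<le> card {u. {f 0, u} \<in> edges G}"
    using e by (intro card_mono) auto
  moreover have "card (f ` {1..n}) = n"
    using f(1) by (subst card_image) (auto simp: inj_on_def)
  ultimately show "\<exists>v \<in> verts G. n \<le> card {u. {v, u} \<in> edges G}"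
    using f(2) by (intro bexI[of _ "f 0"]) auto
next
  assume "\<exists>v \<in> verts G. n \<le> card {u. {v, u} \<in> edges G}"
  then obtain v where v: "v \<in> verts G" "n \<le> card {u. {v, u} \<in> edges G}" by blast
  obtain S where S: "S \<subseteq> {u. {v, u} \<in> edges G}" "card S = n" "finite S"
    using obtain_subset_with_card_n[OF v(2)] by metis
  then obtain g where g: "bij_betw g {1..n} S"
    using finite_same_card_bij[of "{1..n}" S] by auto
  define f where "f = (\<lambda>i. if i = 0 then v else g i)"
  have "{v, v} \<notin> edges G"
    using assms(1) by (auto simp: simple_graph_def)
  then have "v \<notin> S" using S(1) by blast
  have gS: "g i \<in> S" if "i \<in> {1..n}" for i using g that by (auto simp: bij_betw_def)
  have "inj_on f {0..n}"
  proof (rule inj_onI)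
    fix a b assume ab: "a \<in> {0..n}" "b \<in> {0..n}" "f a = f b"
    \<comment> \<open>Membership in \<open>S\<close> tells leaves from the centre, which reduces
      injectivity of \<open>f\<close> to that of \<open>g\<close>.\<close>
    have "f i \<in> S \<longleftrightarrow> i \<noteq> 0" if "i \<in> {0..n}" for i
      using gS[of i] that \<open>v \<notin> S\<close> by (simp add: f_def)
    then have "a = 0 \<longleftrightarrow> b = 0" using ab by metis
    then show "a = b"
      using ab inj_onD[OF bij_betw_imp_inj_on[OF g], of a b] by (cases "a = 0") (auto simp: f_def)
  qed
  moreover have "S \<subseteq> verts G"
    using S(1) assms(1) by (fastforce simp: simple_graph_def)
  then have "f ` {0..n} \<subseteq> verts G"
    using gS v(1) by (auto simp: f_def)
  moreover have "f ` e \<in> edges G" if e: "e \<in> edges (star n)" for e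
  proof -
    obtain i where "e = {0, i}" "i \<in> {1..n}" using e by (auto simp: star_def)
    then show ?thesis using gS[of i] S(1) by (auto simp: f_def insert_commute)
  qed
  ultimately show "contains_copy (star n) G"
    by (auto simp: contains_copy_def star_def)
qed

lemma edge_complete_multipartite_iff:
  "{u, v} \<in> edges (complete_multipartite j t) \<longleftrightarrow>
    u \<in> {..<j} \<times> {..<t} \<and> v \<in> {..<j} \<times> {..<t} \<and> fst u \<noteq> fst v"
proof -
  have "{u, v} \<in> edges (complete_multipartite j t) \<longleftrightarrow>
      (\<exists>a b. {u, v} = {a, b} \<and> a \<in> {..<j} \<times> {..<t} \<and> b \<in> {..<j} \<times> {..<t} \<and> fst a \<noteq> fst b)"
    by (simp only: complete_multipartite_def snd_conv mem_Collect_eq)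
  also have "\<dots> \<longleftrightarrow> u \<in> {..<j} \<times> {..<t} \<and> v \<in> {..<j} \<times> {..<t} \<and> fst u \<noteq> fst v"
    (is "?L \<longleftrightarrow> ?R")
  proof
    assume ?L
    then show ?R by (elim exE conjE) (auto simp only: doubleton_eq_iff)
  next
    assume ?R
    then show ?L by (intro exI[of _ u] exI[of _ v]) simp
  qed
  finally show ?thesis .
qed

lemma arrows_iff:
  "ramsey_arrows (complete_multipartite j t) (complete_graph 3) (star n) \<longleftrightarrow>
    (\<forall>c. let E = (\<lambda>x u v. {u, v} \<in> edges (complete_multipartite j t) \<and> c {u, v} = x) in
      (\<exists>u v w. E Red u v \<and> E Red v w \<and> E Red u w) \<or>
      (\<exists>v \<in> {..<j} \<times> {..<t}. n \<le> card {u. E Blue v u}))"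
proof -
  have "simple_graph (colour_class (complete_multipartite j t) c x)" for c x
    by (intro simple_graph_colour_class simple_graph_complete_multipartite)
  moreover have "verts (colour_class (complete_multipartite j t) c x) = {..<j} \<times> {..<t}" for c x
    by (simp add: colour_class_def complete_multipartite_def)
  ultimately show ?thesis
    by (simp add: ramsey_arrows_def contains_triangle_iff contains_star_iff Let_def)
      (simp add: colour_class_def)
qed

section \<open>The upper bound: large parts force a red triangle or a blue star\<close>

lemma arrows_of_large_parts:
  assumes "j \<ge> 3" "k = (j - 1) div 2" "n \<le> k * t" "t > 0"
  shows "ramsey_arrows (complete_multipartite j t) (complete_graph 3) (star n)"
proof (unfold arrows_iff Let_def, intro allI, rule disjCI)
  fix c :: "(nat \<times> nat) set \<Rightarrow> colour"
  let ?V = "{..<j} \<times> {..<t}"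
  define E where "E = (\<lambda>x u v. {u, v} \<in> edges (complete_multipartite j t) \<and> c {u, v} = x)"
  assume "\<not> (\<exists>v \<in> ?V. n \<le> card {u. {v, u} \<in> edges (complete_multipartite j t) \<and> c {v, u} = Blue})"
  then have blue: "card {u. E Blue v u} < n" if "v \<in> ?V" for v
    using that by (auto simp: E_def not_le)
  have "\<exists>u v w. E Red u v \<and> E Red v w \<and> E Red u w"
  proof (rule ccontr)
    assume no: "\<not> ?thesis"
    interpret triangle_free_multipartite j t "E Red"
    proof
      show "E Red v u" if "E Red u v" for u v using that by (simp add: E_def insert_commute)
      show False if "E Red u v" "E Red v w" "E Red u w" for u v w using that no by blast
    qed (auto simp: E_def edge_complete_multipartite_iff)
    \<comment> \<open>The red degree of this vertex is so small that its blue degree is at least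
      \<open>k * t\<close>, hence at least \<open>n\<close>.\<close>
    obtain v where v: "v \<in> ?V" "card (nbrs v) \<le> (j - 1 - k) * t"
      using min_degree_bound assms by blast
    have "({..<j} - {fst v}) \<times> {..<t} = nbrs v \<union> {u. E Blue v u}"
    proof (rule set_eqI)
      fix u
      have "u \<in> ({..<j} - {fst v}) \<times> {..<t} \<longleftrightarrow> u \<in> ?V \<and> fst v \<noteq> fst u"
        by (auto simp: mem_Times_iff)
      also have "\<dots> \<longleftrightarrow> E Red v u \<or> E Blue v u"
        using v(1) by (cases "c {v, u}") (simp_all add: E_def edge_complete_multipartite_iff)
      also have "\<dots> \<longleftrightarrow> u \<in> nbrs v \<union> {u. E Blue v u}"
        by (simp add: nbrs_def)
      finally show "u \<in> ({..<j} - {fst v}) \<times> {..<t} \<longleftrightarrow> u \<in> nbrs v \<union> {u. E Blue v u}" .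
    qed
    then have "card (({..<j} - {fst v}) \<times> {..<t}) \<le> card (nbrs v) + card {u. E Blue v u}"
      by (simp add: card_Un_le)
    moreover have "card (({..<j} - {fst v}) \<times> {..<t}) = (j - 1) * t"
      using v(1) by (auto simp: card_cartesian_product)
    moreover have "(j - 1) * t = (j - 1 - k) * t + k * t"
      using assms by (simp flip: add_mult_distrib)
    ultimately show False
      using v(2) blue[OF v(1)] assms(3) by linarith
  qed
  then show "\<exists>u v w. ({u, v} \<in> edges (complete_multipartite j t) \<and> c {u, v} = Red) \<and>
      ({v, w} \<in> edges (complete_multipartite j t) \<and> c {v, w} = Red) \<and>
      ({u, w} \<in> edges (complete_multipartite j t) \<and> c {u, w} = Red)"
    by (simp add: E_def)
qed

section \<open>The lower bound: the parity colouring\<close>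

lemma card_same_parity:
  assumes "i < j"
  shows "card {l. l < j \<and> l \<noteq> i \<and> (even l \<longleftrightarrow> even i)} \<le> (j - 1) div 2"
proof -
  let ?S = "{l. l < j \<and> l \<noteq> i \<and> (even l \<longleftrightarrow> even i)}"
  \<comment> \<open>Halving is injective on numbers of equal parity; it maps \<open>?S\<close> into
    the numbers up to \<open>(j - 1) div 2\<close> and misses \<open>i div 2\<close>.\<close>
  have inj: "l = m" if "l div 2 = m div 2" "even l \<longleftrightarrow> even m" for l m :: nat
    using that by presburger
  have "inj_on (\<lambda>l. l div 2) ?S"
    by (rule inj_onI, rule inj) auto
  then have "card ?S = card ((\<lambda>l. l div 2) ` ?S)"
    by (simp add: card_image)
  also have "\<dots> \<le> card ({..(j - 1) div 2} - {i div 2})"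
  proof (intro card_mono image_subsetI)
    fix l assume l: "l \<in> ?S"
    then have "l div 2 \<noteq> i div 2" using inj[of l i] by auto
    moreover have "l div 2 \<le> (j - 1) div 2" using l by (intro div_le_mono) auto
    ultimately show "l div 2 \<in> {..(j - 1) div 2} - {i div 2}" by auto
  qed auto
  also have "\<dots> = (j - 1) div 2"
  proof -
    have "i div 2 \<le> (j - 1) div 2" using assms by (intro div_le_mono) auto
    then show ?thesis by simp
  qed
  finally show ?thesis .
qed

lemma not_arrows_of_small_parts:
  assumes "(j - 1) div 2 * t < n"
  shows "\<not> ramsey_arrows (complete_multipartite j t) (complete_graph 3) (star n)"
proof
  \<comment> \<open>The condition on parities is symmetric, so the colour does not depend on how the
    unordered pair is written; the next step confirms this.\<close>
  define c where "c = (\<lambda>e::(nat \<times> nat) set.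
    if \<exists>u v. e = {u, v} \<and> (even (fst u) \<longleftrightarrow> odd (fst v)) then Red else Blue)"
  have c: "c {u, v} = Red \<longleftrightarrow> (even (fst u) \<longleftrightarrow> odd (fst v))" for u v
  proof -
    have "(\<exists>u' v'. {u, v} = {u', v'} \<and> (even (fst u') \<longleftrightarrow> odd (fst v'))) \<longleftrightarrow>
        (even (fst u) \<longleftrightarrow> odd (fst v))"
      (is "?L \<longleftrightarrow> ?R")
    proof
      assume ?L
      then show ?R by (elim exE conjE) (auto simp only: doubleton_eq_iff)
    next
      assume ?R
      then show ?L by (intro exI[of _ u] exI[of _ v]) simp
    qed
    then show ?thesis by (simp add: c_def)
  qed
  have c': "c {u, v} = Blue \<longleftrightarrow> (even (fst u) \<longleftrightarrow> even (fst v))" for u v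
    using c[of u v] by (cases "c {u, v}") auto
  assume "ramsey_arrows (complete_multipartite j t) (complete_graph 3) (star n)"
  then obtain v where v: "v \<in> {..<j} \<times> {..<t}"
    "n \<le> card {u. {v, u} \<in> edges (complete_multipartite j t) \<and> c {v, u} = Blue}"
    \<comment> \<open>The red triangle is excluded because three parities cannot be pairwise
      different.\<close>
    unfolding arrows_iff Let_def by (elim allE[of _ c]) (simp only: c, blast)
  let ?S = "{l. l < j \<and> l \<noteq> fst v \<and> (even l \<longleftrightarrow> even (fst v))}"
  have "{u. {v, u} \<in> edges (complete_multipartite j t) \<and> c {v, u} = Blue} \<subseteq> ?S \<times> {..<t}"
    by (auto simp: edge_complete_multipartite_iff c')
  then have "card {u. {v, u} \<in> edges (complete_multipartite j t) \<and> c {v, u} = Blue}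
      \<le> card (?S \<times> {..<t})"
    by (intro card_mono) auto
  also have "\<dots> = card ?S * t" by (simp add: card_cartesian_product)
  also have "\<dots> \<le> (j - 1) div 2 * t"
    using v(1) by (intro mult_right_mono card_same_parity) auto
  finally show False using v(2) assms by simp
qed

section \<open>The exact value\<close>

theorem theorem6:
  fixes n j :: nat
  assumes "n \<ge> 2" and "j \<ge> 3"
  shows "int (multipartite_ramsey j (complete_graph 3) (star n)) =
    \<lfloor>(real n - 1) / (real_of_int \<lceil>real j / 2\<rceil> - 1)\<rfloor> + 1"
proof -
  \<comment> \<open>This is the denominator \<open>\<lceil>real j / 2\<rceil> - 1\<close> as a
    natural number.\<close>
  define k where "k = (j - 1) div 2"
  have "k > 0" using assms by (simp add: k_def)
  \<comment> \<open>The least \<open>t\<close> with \<open>n \<le> k * t\<close> is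
    \<open>(n - 1) div k + 1\<close>, so the two bounds meet exactly there.\<close>
  have t0: "k * t < n \<longleftrightarrow> t < (n - 1) div k + 1" for t
  proof -
    have "k * t < n \<longleftrightarrow> t * k \<le> n - 1" using assms by (auto simp: mult.commute)
    also have "\<dots> \<longleftrightarrow> t \<le> (n - 1) div k" using \<open>k > 0\<close> by (simp add: less_eq_div_iff_mult_less_eq)
    finally show ?thesis by auto
  qed
  have "multipartite_ramsey j (complete_graph 3) (star n) = (n - 1) div k + 1"
    unfolding multipartite_ramsey_def
  proof (rule Least_equality)
    show "1 \<le> (n - 1) div k + 1 \<and>
        ramsey_arrows (complete_multipartite j ((n - 1) div k + 1)) (complete_graph 3) (star n)"
      using arrows_of_large_parts[OF assms(2) k_def, of n "(n - 1) div k + 1"]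
        t0[of "(n - 1) div k + 1"] by (simp del: mult_Suc_right)
    show "(n - 1) div k + 1 \<le> t"
      if "1 \<le> t \<and> ramsey_arrows (complete_multipartite j t) (complete_graph 3) (star n)" for t
      using not_arrows_of_small_parts[of j t n] t0[of t] that by (auto simp: k_def not_less)
  qed
  moreover have "\<lceil>real j / 2\<rceil> = int k + 1"
  proof -
    have "j = 2 * k + 1 \<or> j = 2 * k + 2" using assms by (auto simp: k_def)
    then show ?thesis by (intro ceiling_unique) auto
  qed
  moreover have "\<lfloor>(real n - 1) / real k\<rfloor> = int ((n - 1) div k)"
    using floor_divide_of_nat_eq[of "n - 1" k, where 'a = real] assms by (simp add: of_nat_diff)
  ultimately show ?thesis by simp
qed

end
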